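(* Let $\theta:\mathbb{R}^n\to\mathbb{R}$ be a proper convex (not necessarily smooth) function, $\mathcal{X}\subseteq\mathbb{R}^n$ a closed convex set, $A\in\mathbb{R}^{m\times n}$ and $b\in\mathbb{R}^m$. The sequence $\{w^k\}=\{(x^k,\lambda^k)\}$ generated by the dual-primal balanced augmented Lagrangian method (defined in the context) converges to some $w^\infty\in\Omega^*$ (defined in the context) for any $\beta>0$, $\delta>0$ and $\alpha\in(0,2)$.
   Context: The problem under consideration is $\min\{\theta(x)\mid Ax=b,\ x\in\mathcal{X}\}$. Put $\Omega=\mathcal{X}\times\mathbb{R}^m$, $w=(x,\lambda)$ and $F(w)=\begin{pmatrix}-A^T\lambda\\ Ax-b\end{pmatrix}$. The set $\Omega^*$ is the solution set of the variational inequality associated with the problem, that is, the set of all $w^*=(x^*,\lambda^* )\in\Omega$ such that $$\theta(x)-\theta(x^* )+(w-w^* )^TF(w^* )\ge 0\quad\text{for all } w=(x,\lambda)\in\Omega$$ (equivalently, the saddle points over $\mathcal{X}\times\mathbb{R}^m$ of the Lagrangian $L(x,\lambda)=\theta(x)-\lambda^T(Ax-b)$). The dual-primal balanced augmented Lagrangian method with parameters $\beta>0$, $\delta>0$, $\alpha\in(0,2)$ generates, from a given $(x^k,\lambda^k)\in\mathbb{R}^n\times\mathbb{R}^m$, $k=0,1,2,\ldots$, the next iterate $(x^{k+1},\lambda^{k+1})$ by $$\bar\lambda^k=\lambda^k-\Big(\tfrac1\beta AA^T+\delta I_m\Big)^{-1}(Ax^k-b),$$ $$\bar x^k=\arg\min\Big\{\theta(x)+\tfrac{\beta}{2}\big\|x-[x^k+\tfrac1\beta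 A^T(2\bar\lambda^k-\lambda^k)]\big\|_2^2\ \Big|\ x\in\mathcal{X}\Big\},$$ $$x^{k+1}=x^k+\alpha(\bar x^k-x^k),\qquad \lambda^{k+1}=\lambda^k+\alpha(\bar\lambda^k-\lambda^k).$$ Here $I_m$ is the $m\times m$ identity matrix.
   Formalization: The formal theorem additionally assumes that the solution set Ω* is nonempty; without this the claim fails (e.g. θ=0, X=R, A=0, b=1, where Ω* is empty), and the conclusion itself forces Ω* to be nonempty. *)

theory Defs
  imports "HOL-Analysis.Analysis"
begin

type_synonym ('n, 'm) primal_dual = "(real ^ 'n) \<times> (real ^ 'm)"

definition VI_operator ::
    "real ^ 'n ^ 'm \<Rightarrow> real ^ 'm \<Rightarrow> ('n, 'm) primal_dual \<Rightarrow> ('n, 'm) primal_dual" where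
  "VI_operator A b w = (- (transpose A *v snd w), A *v fst w - b)"

text \<open>The inner product below is the one of the product space, i.e. the sum of the
  inner products of the two components.\<close>

definition VI_solutions ::
    "(real ^ 'n \<Rightarrow> real) \<Rightarrow> (real ^ 'n) set \<Rightarrow> real ^ 'n ^ 'm \<Rightarrow> real ^ 'm
      \<Rightarrow> ('n, 'm) primal_dual set" where
  "VI_solutions \<theta> X A b =
    {w' \<in> X \<times> UNIV. \<forall>w \<in> X \<times> UNIV.
        \<theta> (fst w) - \<theta> (fst w') + (w - w') \<bullet> VI_operator A b w' \<ge> 0}"

definition dual_predictor ::
    "real ^ 'n ^ 'm \<Rightarrow> real ^ 'm \<Rightarrow> real \<Rightarrow> real \<Rightarrow> ('n, 'm) primal_dual \<Rightarrow> real ^ 'm" where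
  "dual_predictor A b \<beta> \<delta> w =
    snd w - matrix_inv ((1 / \<beta>) *\<^sub>R (A ** transpose A) + \<delta> *\<^sub>R mat 1) *v (A *v fst w - b)"

text \<open>For convex \<open>\<theta>\<close>, closed convex nonempty \<open>X\<close> and positive \<open>\<beta>\<close> the objective below has exactly
  one minimiser over \<open>X\<close>, so \<^const>\<open>arg_min\<close> involves no actual choice.\<close>

definition primal_predictor ::
    "(real ^ 'n \<Rightarrow> real) \<Rightarrow> (real ^ 'n) set \<Rightarrow> real ^ 'n ^ 'm \<Rightarrow> real ^ 'm \<Rightarrow> real \<Rightarrow> real
      \<Rightarrow> ('n, 'm) primal_dual \<Rightarrow> real ^ 'n" where
  "primal_predictor \<theta> X A b \<beta> \<delta> w =
    arg_min
      (\<lambda>x. \<theta> x + \<beta> / 2 *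
        (norm (x - (fst w + (1 / \<beta>) *\<^sub>R
           (transpose A *v (2 *\<^sub>R dual_predictor A b \<beta> \<delta> w - snd w)))))\<^sup>2)
      (\<lambda>x. x \<in> X)"

definition dp_balm_step ::
    "(real ^ 'n \<Rightarrow> real) \<Rightarrow> (real ^ 'n) set \<Rightarrow> real ^ 'n ^ 'm \<Rightarrow> real ^ 'm \<Rightarrow> real \<Rightarrow> real \<Rightarrow> real
      \<Rightarrow> ('n, 'm) primal_dual \<Rightarrow> ('n, 'm) primal_dual" where
  "dp_balm_step \<theta> X A b \<beta> \<delta> \<alpha> w =
    (fst w + \<alpha> *\<^sub>R (primal_predictor \<theta> X A b \<beta> \<delta> w - fst w),
     snd w + \<alpha> *\<^sub>R (dual_predictor A b \<beta> \<delta> w - snd w))"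

end

theory Submission
  imports Defs "HOL-Real_Asymp.Real_Asymp"
begin

text \<open>
  Put \<open>M = A A\<^sup>T / \<beta> + \<delta> I\<close>, and let \<open>v\<close> be the predictor computed from \<open>w\<close>.  The optimality condition
  of the proximal step and the equation defining the dual predictor combine into the variational
  inequality at \<open>v\<close>, with the perturbation \<open>H (w - v)\<close> where \<open>H\<close> is the symmetric block matrix with
  rows \<open>(\<beta> I, - A\<^sup>T)\<close> and \<open>(- A, M)\<close>.  The choice of \<open>M\<close> makes \<open>H\<close> positive definite:
  its quadratic form at \<open>(x, y)\<close> is \<open>\<beta> |x - A\<^sup>T y / \<beta>|\<^sup>2 + \<delta> |y|\<^sup>2\<close>.  As the VI operator is skew up to a
  constant, the relaxed step is Fejer monotone in the \<open>H\<close>-norm with respect to the solutions, with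
  decrease \<open>\<alpha> (2 - \<alpha>) |w - v|\<^sup>2\<close> of the squared distance in that norm.  Hence the residuals \<open>w - v\<close> vanish, every cluster point solves the
  unperturbed inequality, and the whole sequence converges.
\<close>

section \<open>Fejer monotone sequences\<close>

text \<open>Boundedness provides a cluster point \<open>l\<close>, and since \<open>l\<close> lies
  in \<open>S\<close> the distance to \<open>l\<close> itself never increases. Once one term of the
  subsequence is close to \<open>l\<close>, all later terms of \<open>u\<close> stay close.\<close>

lemma Fejer_monotone_converges:
  fixes u :: "nat \<Rightarrow> 'a::heine_borel"
  assumes "S \<noteq> {}"
    and mono: "\<And>z k. z \<in> S \<Longrightarrow> dist (u (Suc k)) z \<le> dist (u k) z"
    and cluster: "\<And>r l. strict_mono r \<Longrightarrow> (u \<circ> r) \<longlonglongrightarrow> l \<Longrightarrow> l \<in> S"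
  shows "\<exists>l\<in>S. u \<longlonglongrightarrow> l"
proof -
  have decr: "decseq (\<lambda>k. dist (u k) z)" if "z \<in> S" for z
    using mono[OF that] by (rule decseq_SucI)
  obtain z where "z \<in> S" using \<open>S \<noteq> {}\<close> by blast
  have "range u \<subseteq> cball z (dist (u 0) z)"
    using decseqD[OF decr[OF \<open>z \<in> S\<close>], of 0] by (auto simp: dist_commute)
  then have "bounded (range u)"
    using bounded_cball bounded_subset by blast
  then obtain l r where r: "strict_mono r" "(u \<circ> r) \<longlonglongrightarrow> l"
    using bounded_imp_convergent_subsequence by blast
  then have "l \<in> S" by (rule cluster)
  have "u \<longlonglongrightarrow> l"
  proof (rule metric_LIMSEQ_I)
    fix e :: real assume "e > 0"
    then obtain N where "dist ((u \<circ> r) N) l < e"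
      using metric_LIMSEQ_D[OF r(2)] by blast
    then show "\<exists>N. \<forall>n\<ge>N. dist (u n) l < e"
      using decseqD[OF decr[OF \<open>l \<in> S\<close>], of "r N"] by (intro exI[of _ "r N"]) fastforce
  qed
  with \<open>l \<in> S\<close> show ?thesis by blast
qed

section \<open>Proximal points\<close>

lemma convex_on_UNIV_continuous:
  fixes \<theta> :: "'a::euclidean_space \<Rightarrow> real"
  assumes "convex_on UNIV \<theta>"
  shows "continuous_on S \<theta>"
  using convex_on_continuous[OF open_UNIV assms] continuous_on_subset by blast

text \<open>Convexity compares a distant \<open>x\<close> with the point of the unit sphere around
  \<open>a\<close> on the segment to \<open>x\<close>, where \<theta> is bounded by compactness. So
  \<theta> falls at most linearly, and the quadratic term of a proximal problem outweighs
  it.\<close>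

lemma convex_on_lower_bound:
  fixes \<theta> :: "'a::euclidean_space \<Rightarrow> real"
  assumes conv: "convex_on UNIV \<theta>"
  obtains K where "\<And>x. \<theta> x \<ge> - K * (1 + norm (x - a))"
proof -
  have "compact (\<theta> ` cball a 1)"
    by (intro compact_continuous_image convex_on_UNIV_continuous[OF conv] compact_cball)
  then obtain B where B: "\<And>x. x \<in> cball a 1 \<Longrightarrow> \<bar>\<theta> x\<bar> \<le> B"
    using compact_imp_bounded bounded_real by (metis imageI)
  have "B \<ge> 0" using B[of a] by simp
  \<comment> \<open>At distance t > 1 the comparison gives
    \<open>\<theta> x \<ge> - B * t - (t - 1) * B\<close>, whence the factor 2.\<close>
  have "\<theta> x \<ge> - (2 * B) * (1 + norm (x - a))" for x
  proof (cases "norm (x - a) \<le> 1")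
    case True
    then have "x \<in> cball a 1" by (simp add: dist_norm norm_minus_commute)
    then have "\<theta> x \<ge> - B" using B by fastforce
    moreover have "2 * B * 1 \<le> 2 * B * (1 + norm (x - a))"
      using \<open>B \<ge> 0\<close> by (intro mult_left_mono) auto
    ultimately show ?thesis using \<open>B \<ge> 0\<close> by linarith
  next
    case False
    define t where "t = norm (x - a)"
    have "t > 1" using False by (simp add: t_def)
    define y where "y = (1 - 1/t) *\<^sub>R a + (1/t) *\<^sub>R x"
    have "y - a = (1/t) *\<^sub>R (x - a)" by (simp add: y_def algebra_simps)
    then have "norm (y - a) = 1 / t * t" using \<open>t > 1\<close> by (simp add: t_def)
    then have "norm (y - a) = 1" using \<open>t > 1\<close> by simp
    then have "y \<in> cball a 1" by (simp add: dist_norm norm_minus_commute)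
    then have "- B \<le> \<theta> y" using B by fastforce
    also have "\<theta> y \<le> (1 - 1/t) * \<theta> a + (1/t) * \<theta> x"
      unfolding y_def using \<open>t > 1\<close> by (intro convex_onD[OF conv]) auto
    finally have "- B * t \<le> ((1 - 1/t) * \<theta> a + (1/t) * \<theta> x) * t"
      using \<open>t > 1\<close> by (intro mult_right_mono) auto
    also have "\<dots> = (t - 1) * \<theta> a + \<theta> x" using \<open>t > 1\<close> by (simp add: field_simps)
    also have "(t - 1) * \<theta> a \<le> (t - 1) * B"
      using \<open>t > 1\<close> B[of a] by (intro mult_left_mono) auto
    finally show ?thesis using \<open>B \<ge> 0\<close> unfolding t_def[symmetric] by (simp add: algebra_simps)
  qed
  then show ?thesis by (rule that)
qed

text \<open>Quadratic growth beats the linear lower bound, so outside a large ball around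
  \<open>c\<close> the objective exceeds its value at a fixed \<open>x0\<close> in \<open>X\<close>.
  A minimiser over the compact remainder is therefore global.\<close>

lemma proximal_point_exists:
  fixes \<theta> :: "'a::euclidean_space \<Rightarrow> real"
  assumes conv: "convex_on UNIV \<theta>" and "closed X" "X \<noteq> {}" "\<beta> > 0"
  shows "\<exists>x. is_arg_min (\<lambda>x. \<theta> x + \<beta> / 2 * (norm (x - c))\<^sup>2) (\<lambda>x. x \<in> X) x"
proof -
  define f where "f = (\<lambda>x. \<theta> x + \<beta> / 2 * (norm (x - c))\<^sup>2)"
  obtain K where K: "\<And>x. \<theta> x \<ge> - K * (1 + norm (x - c))"
    using convex_on_lower_bound[OF conv] by metis
  obtain x0 where "x0 \<in> X" using \<open>X \<noteq> {}\<close> by blast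
  have "filterlim (\<lambda>t. - K * (1 + t) + \<beta> / 2 * t\<^sup>2) at_top at_top"
    using \<open>\<beta> > 0\<close> by real_asymp
  then have "eventually (\<lambda>t. - K * (1 + t) + \<beta> / 2 * t\<^sup>2 > f x0) at_top"
    by (simp add: filterlim_at_top_dense)
  then obtain R where R: "\<And>t. t \<ge> R \<Longrightarrow> - K * (1 + t) + \<beta> / 2 * t\<^sup>2 > f x0"
    by (auto simp: eventually_at_top_linorder)
  have far: "f x > f x0" if "norm (x - c) \<ge> R" for x
    using R[OF that] K[of x] by (simp add: f_def)
  have "compact (X \<inter> cball c R)" using \<open>closed X\<close> by (intro closed_Int_compact compact_cball)
  moreover have near: "x \<in> cball c R" if "f x \<le> f x0" for x
    using far[of x] that by (force simp: dist_norm norm_minus_commute)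
  moreover have "continuous_on (X \<inter> cball c R) f"
    unfolding f_def by (intro continuous_intros convex_on_UNIV_continuous[OF conv])
  ultimately obtain x where x: "x \<in> X" "\<And>y. y \<in> X \<inter> cball c R \<Longrightarrow> f x \<le> f y"
    using continuous_attains_inf[of "X \<inter> cball c R" f] \<open>x0 \<in> X\<close> by blast
  have "f x \<le> f x0" using x(2) near[of x0] \<open>x0 \<in> X\<close> by simp
  then have "f x \<le> f y" if "y \<in> X" for y
    using x(2)[of y] near[of y] that by fastforce
  then show ?thesis using x(1) unfolding f_def[symmetric] is_arg_min_linorder by blast
qed

text \<open>Only the quadratic term is differentiated: \<open>p\<close> is compared with points of
  the segment from \<open>p\<close> to \<open>x\<close>, along which convexity bounds the possibly
  nonsmooth \<theta> by a linear interpolation.\<close>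

lemma proximal_point_VI:
  fixes \<theta> :: "'a::real_inner \<Rightarrow> real"
  assumes conv: "convex_on X \<theta>" and "x \<in> X"
    and min: "is_arg_min (\<lambda>x. \<theta> x + \<beta> / 2 * (norm (x - c))\<^sup>2) (\<lambda>x. x \<in> X) p"
  shows "\<theta> x - \<theta> p + \<beta> * ((x - p) \<bullet> (p - c)) \<ge> 0"
proof -
  \<comment> \<open>Moving from \<open>p\<close> by \<open>t *\<^sub>R (x - p)\<close> raises the
    objective by at most \<open>t * E + t * t * K\<close>. Dividing by t and letting t decrease to 0
    leaves \<open>E\<close>.\<close>
  define E where "E = \<theta> x - \<theta> p + \<beta> * ((x - p) \<bullet> (p - c))"
  define K where "K = \<beta> / 2 * (norm (x - p))\<^sup>2"
  have "p \<in> X" and p: "\<And>y. y \<in> X \<Longrightarrow> \<theta> p + \<beta> / 2 * (norm (p - c))\<^sup>2 \<le> \<theta> y + \<beta> / 2 * (norm (y - c))\<^sup>2"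
    using min by (auto simp: is_arg_min_linorder)
  have "convex X" using conv by (simp add: convex_on_def)
  have E: "E + t * K \<ge> 0" if t: "0 < t" "t \<le> 1" for t
  proof -
    define y where "y = (1 - t) *\<^sub>R p + t *\<^sub>R x"
    have "y \<in> X" unfolding y_def using \<open>convex X\<close> \<open>p \<in> X\<close> \<open>x \<in> X\<close> t by (intro convexD) auto
    have "y - c = (p - c) + t *\<^sub>R (x - p)" by (simp add: y_def algebra_simps)
    then have "(norm (y - c))\<^sup>2 = (norm (p - c))\<^sup>2 + 2 * t * ((x - p) \<bullet> (p - c)) + t\<^sup>2 * (norm (x - p))\<^sup>2"
      by (simp only: power2_norm_eq_inner)
        (simp add: inner_add_left inner_add_right inner_commute power2_eq_square)
    then have "\<beta> / 2 * (norm (y - c))\<^sup>2 = \<beta> / 2 * (norm (p - c))\<^sup>2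
        + t * (\<beta> * ((x - p) \<bullet> (p - c))) + t * (t * K)"
      by (simp only: K_def) (simp add: field_simps power2_eq_square[of t])
    moreover have "\<theta> y \<le> (1 - t) * \<theta> p + t * \<theta> x"
      unfolding y_def using t \<open>p \<in> X\<close> \<open>x \<in> X\<close> by (intro convex_onD[OF conv]) auto
    moreover have "t * (E + t * K) =
        t * \<theta> x - t * \<theta> p + t * (\<beta> * ((x - p) \<bullet> (p - c))) + t * (t * K)"
      by (simp only: E_def ring_distribs)
    ultimately have "0 \<le> t * (E + t * K)"
      using p[OF \<open>y \<in> X\<close>] unfolding left_diff_distrib by linarith
    then show ?thesis using t by (simp add: zero_le_mult_iff)
  qed
  have "((\<lambda>t. E + t * K) \<longlongrightarrow> E + 0 * K) (at_right 0)"
    by (intro tendsto_intros)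
  moreover have "eventually (\<lambda>t. E + t * K \<ge> 0) (at_right 0)"
    using E by (auto simp: eventually_at_right_field intro!: exI[of _ 1])
  ultimately have "E + 0 * K \<ge> 0" by (rule tendsto_lowerbound) simp
  then show ?thesis by (simp add: E_def)
qed

section \<open>The predictor\<close>

lemma inner_matrix_transpose:
  fixes A :: "real ^ 'n ^ 'm"
  shows "y \<bullet> (A *v x) = (transpose A *v y) \<bullet> x"
  by (simp add: dot_lmul_matrix transpose_matrix_vector)

lemma matrix_inv_right:
  fixes M :: "real ^ 'n ^ 'm"
  assumes "invertible M"
  shows "M ** matrix_inv M = mat 1"
  unfolding matrix_inv_def using someI_ex[OF assms[unfolded invertible_def]] by (rule conjunct1)

lemma regularized_gram_inner:
  fixes A :: "real ^ 'n ^ 'm"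
  shows "y \<bullet> ((c *\<^sub>R (A ** transpose A) + d *\<^sub>R mat 1) *v z) =
    c * ((transpose A *v y) \<bullet> (transpose A *v z)) + d * (y \<bullet> z)"
  by (simp add: matrix_vector_mult_add_rdistrib scaleR_matrix_vector_assoc[symmetric]
      matrix_vector_mul_assoc[symmetric] inner_add_right inner_matrix_transpose)

text \<open>The matrix is positive definite, so its kernel is trivial.\<close>

lemma regularized_gram_invertible:
  fixes A :: "real ^ 'n ^ 'm"
  assumes "c \<ge> 0" "d > 0"
  shows "invertible (c *\<^sub>R (A ** transpose A) + d *\<^sub>R mat 1)"
proof -
  have "z = 0" if "(c *\<^sub>R (A ** transpose A) + d *\<^sub>R mat 1) *v z = 0" for z
  proof -
    have "c * ((transpose A *v z) \<bullet> (transpose A *v z)) + d * (z \<bullet> z) = 0"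
      using regularized_gram_inner[of z c A d z] that by simp
    moreover have "c * ((transpose A *v z) \<bullet> (transpose A *v z)) \<ge> 0"
      using assms by simp
    moreover have "d * (z \<bullet> z) \<ge> 0" using assms by simp
    ultimately have "d * (z \<bullet> z) = 0" by linarith
    then show ?thesis using \<open>d > 0\<close> by simp
  qed
  then show ?thesis
    unfolding invertible_left_inverse matrix_left_invertible_ker by blast
qed

text \<open>The factor \<open>L\<close> in \<open>H = L\<^sup>T L\<close>; it turns the \<open>H\<close>-norm into the Euclidean one.\<close>

definition H_factor :: "real ^ 'n ^ 'm \<Rightarrow> real \<Rightarrow> real \<Rightarrow> ('n, 'm) primal_dual \<Rightarrow> ('n, 'm) primal_dual" where
  "H_factor A \<beta> \<delta> w =
    (sqrt \<beta> *\<^sub>R (fst w - (1 / \<beta>) *\<^sub>R (transpose A *v snd w)), sqrt \<delta> *\<^sub>R snd w)"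

lemma linear_H_factor: "linear (H_factor A \<beta> \<delta>)"
  by (rule linearI)
    (simp_all add: H_factor_def matrix_vector_right_distrib scaleR_matrix_vector_assoc algebra_simps
      matrix_vector_mult_scaleR)

lemma inj_H_factor:
  assumes "\<beta> > 0" "\<delta> > 0"
  shows "inj (H_factor A \<beta> \<delta>)"
  using assms by (auto simp: inj_def H_factor_def prod_eq_iff)

text \<open>Completing the square, run backwards: the last two summands belong to the block
  \<open>M\<close> of \<open>H\<close>, the two negative ones to its off-diagonal blocks.\<close>

lemma inner_H_factor:
  assumes "\<beta> > 0" "\<delta> > 0"
  shows "H_factor A \<beta> \<delta> u \<bullet> H_factor A \<beta> \<delta> v =
    \<beta> * (fst u \<bullet> fst v) - fst u \<bullet> (transpose A *v snd v) - (transpose A *v snd u) \<bullet> fst v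
    + (1 / \<beta>) * ((transpose A *v snd u) \<bullet> (transpose A *v snd v)) + \<delta> * (snd u \<bullet> snd v)"
proof -
  have "H_factor A \<beta> \<delta> u \<bullet> H_factor A \<beta> \<delta> v =
      \<beta> * ((fst u - (1 / \<beta>) *\<^sub>R (transpose A *v snd u)) \<bullet> (fst v - (1 / \<beta>) *\<^sub>R (transpose A *v snd v)))
      + \<delta> * (snd u \<bullet> snd v)"
    using assms by (simp add: H_factor_def inner_prod_def flip: mult.assoc)
  also have "\<dots> = \<beta> * (fst u \<bullet> fst v) - fst u \<bullet> (transpose A *v snd v) - (transpose A *v snd u) \<bullet> fst v
      + (1 / \<beta>) * ((transpose A *v snd u) \<bullet> (transpose A *v snd v)) + \<delta> * (snd u \<bullet> snd v)"
    using assms by (simp add: inner_diff_left inner_diff_right field_simps)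
  finally show ?thesis .
qed

definition predictor ::
    "(real ^ 'n \<Rightarrow> real) \<Rightarrow> (real ^ 'n) set \<Rightarrow> real ^ 'n ^ 'm \<Rightarrow> real ^ 'm \<Rightarrow> real \<Rightarrow> real
      \<Rightarrow> ('n, 'm) primal_dual \<Rightarrow> ('n, 'm) primal_dual" where
  "predictor \<theta> X A b \<beta> \<delta> w = (primal_predictor \<theta> X A b \<beta> \<delta> w, dual_predictor A b \<beta> \<delta> w)"

lemma dp_balm_step_predictor:
  "dp_balm_step \<theta> X A b \<beta> \<delta> \<alpha> w = w - \<alpha> *\<^sub>R (w - predictor \<theta> X A b \<beta> \<delta> w)"
  by (simp add: dp_balm_step_def predictor_def prod_eq_iff algebra_simps)

text \<open>In effect the predictor is a proximal point step in the metric \<open>H\<close>: each of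
  its two defining conditions supplies one block row of \<open>H (w - p)\<close>.\<close>

lemma
  fixes \<theta> :: "real ^ 'n \<Rightarrow> real" and A :: "real ^ 'n ^ 'm" and b :: "real ^ 'm"
    and v w :: "('n, 'm) primal_dual"
  assumes conv: "convex_on UNIV \<theta>" and X: "closed X" "convex X" "X \<noteq> {}"
    and pos: "\<beta> > 0" "\<delta> > 0"
  defines "p \<equiv> predictor \<theta> X A b \<beta> \<delta> w"
  shows predictor_mem: "fst p \<in> X"
    and predictor_VI: "fst v \<in> X \<Longrightarrow>
      \<theta> (fst v) - \<theta> (fst p) + (v - p) \<bullet> VI_operator A b p
        \<ge> H_factor A \<beta> \<delta> (v - p) \<bullet> H_factor A \<beta> \<delta> (w - p)"
proof -
  define c where "c = fst w + (1 / \<beta>) *\<^sub>R (transpose A *v (2 *\<^sub>R snd p - snd w))"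
  have fstp: "fst p = arg_min (\<lambda>x. \<theta> x + \<beta> / 2 * (norm (x - c))\<^sup>2) (\<lambda>x. x \<in> X)"
    by (simp add: p_def predictor_def primal_predictor_def c_def)
  \<comment> \<open>\<open>arg_min\<close> is a Hilbert choice, so the existence of a minimiser
    makes the chosen point one.\<close>
  have min: "is_arg_min (\<lambda>x. \<theta> x + \<beta> / 2 * (norm (x - c))\<^sup>2) (\<lambda>x. x \<in> X) (fst p)"
    unfolding fstp arg_min_def
    using proximal_point_exists[OF conv X(1,3) pos(1)] by (rule someI_ex)
  then show "fst p \<in> X" by (simp add: is_arg_min_def)
  assume "fst v \<in> X"
  define M where "M = (1 / \<beta>) *\<^sub>R (A ** transpose A) + \<delta> *\<^sub>R mat 1"
  have "M ** matrix_inv M = mat 1"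
    using regularized_gram_invertible[of "1 / \<beta>" \<delta> A] pos
    by (intro matrix_inv_right) (simp add: M_def)
  then have "M *v (snd w - snd p) = A *v fst w - b"
    by (simp add: p_def predictor_def dual_predictor_def flip: M_def)
      (simp add: matrix_vector_mul_assoc)
  \<comment> \<open>Splitting \<open>fst w\<close> as \<open>fst p + fst (w - p)\<close> exposes the
    second block row of \<open>H\<close>.\<close>
  then have "A *v fst p - b = M *v snd (w - p) - A *v fst (w - p)"
    by (simp add: matrix_vector_mult_diff_distrib)
  then have dual: "snd (v - p) \<bullet> (A *v fst p - b) =
      (1 / \<beta>) * ((transpose A *v snd (v - p)) \<bullet> (transpose A *v snd (w - p)))
      + \<delta> * (snd (v - p) \<bullet> snd (w - p)) - (transpose A *v snd (v - p)) \<bullet> fst (w - p)"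
    by (simp only: M_def inner_diff_right regularized_gram_inner)
      (simp only: inner_matrix_transpose)
  have "0 \<le> \<theta> (fst v) - \<theta> (fst p) + \<beta> * ((fst v - fst p) \<bullet> (fst p - c))"
    using proximal_point_VI[OF convex_on_subset[OF conv] \<open>fst v \<in> X\<close> min] X(2) by simp
  also have "\<beta> * ((fst v - fst p) \<bullet> (fst p - c)) = (fst v - fst p) \<bullet> (\<beta> *\<^sub>R (fst p - c))"
    by simp
  \<comment> \<open>The extrapolated multiplier is \<open>snd p - snd (w - p)\<close>. Its first
    part gives the operator at \<open>p\<close>; its second gives the off-diagonal block of the
    first row, which makes \<open>H\<close> symmetric.\<close>
  also have "\<beta> *\<^sub>R (fst p - c) =
      transpose A *v snd (w - p) - \<beta> *\<^sub>R fst (w - p) - transpose A *v snd p"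
  proof -
    have "2 *\<^sub>R snd p - snd w = snd p - snd (w - p)" by (simp add: scaleR_2)
    then have "c = fst w + (1 / \<beta>) *\<^sub>R (transpose A *v snd p - transpose A *v snd (w - p))"
      by (simp only: c_def matrix_vector_mult_diff_distrib)
    moreover have "\<beta> *\<^sub>R (fst p - (fst w + (1 / \<beta>) *\<^sub>R (g - h))) = h - \<beta> *\<^sub>R fst (w - p) - g" for g h
      using pos by (simp add: algebra_simps)
    ultimately show ?thesis by simp
  qed
  finally show "\<theta> (fst v) - \<theta> (fst p) + (v - p) \<bullet> VI_operator A b p
        \<ge> H_factor A \<beta> \<delta> (v - p) \<bullet> H_factor A \<beta> \<delta> (w - p)"
    unfolding inner_H_factor[OF pos] VI_operator_def inner_prod_def[of "v - p"]
    using dual by (simp add: inner_diff_right[of "fst v - fst p"])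
qed

text \<open>The linear part of the operator is skew, so its increment is orthogonal to
  \<open>u - v\<close>. This lets the inequality at a solution be added to the one at the
  predictor.\<close>

lemma VI_operator_skew:
  "(u - v) \<bullet> VI_operator A b u = (u - v) \<bullet> VI_operator A b v"
proof -
  have "(u - v) \<bullet> (VI_operator A b u - VI_operator A b v) =
      (u - v) \<bullet> (- (transpose A *v snd (u - v)), A *v fst (u - v))"
    by (simp add: VI_operator_def matrix_vector_mult_diff_distrib)
  also have "\<dots> = 0" by (simp add: inner_prod_def inner_matrix_transpose inner_commute)
  finally show ?thesis by (simp add: inner_diff_right)
qed

text \<open>Testing the solution inequality at \<open>p\<close> and the predictor inequality at
  \<open>z\<close>, then adding, cancels \<theta> and the operator and leaves
  \<open>d \<bullet> d \<le> e \<bullet> d\<close>. Expanding the square of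
  \<open>e - \<alpha> *\<^sub>R d\<close> gives the decrease.\<close>

lemma H_factor_contraction:
  fixes \<theta> :: "real ^ 'n \<Rightarrow> real" and A :: "real ^ 'n ^ 'm"
  assumes conv: "convex_on UNIV \<theta>" and X: "closed X" "convex X" and pos: "\<beta> > 0" "\<delta> > 0" "\<alpha> > 0"
    and z: "z \<in> VI_solutions \<theta> X A b"
  defines "L \<equiv> H_factor A \<beta> \<delta>"
  shows "(norm (L (dp_balm_step \<theta> X A b \<beta> \<delta> \<alpha> w) - L z))\<^sup>2
    \<le> (norm (L w - L z))\<^sup>2 - \<alpha> * (2 - \<alpha>) * (norm (L (w - predictor \<theta> X A b \<beta> \<delta> w)))\<^sup>2"
proof -
  define p where "p = predictor \<theta> X A b \<beta> \<delta> w"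
  interpret L: linear L unfolding L_def by (rule linear_H_factor)
  define e d where "e = L w - L z" and "d = L (w - p)"
  have "fst z \<in> X" using z by (auto simp: VI_solutions_def)
  then have "X \<noteq> {}" by blast
  note pred = predictor_mem[OF conv X this pos(1,2), of A b w, folded p_def]
    predictor_VI[OF conv X this pos(1,2) \<open>fst z \<in> X\<close>, of A b w, folded p_def L_def]
  have "0 \<le> \<theta> (fst p) - \<theta> (fst z) + (p - z) \<bullet> VI_operator A b z"
    using z pred(1) by (cases p) (auto simp: VI_solutions_def)
  moreover have "(p - z) \<bullet> VI_operator A b z = - ((z - p) \<bullet> VI_operator A b p)"
    using VI_operator_skew[of p z A b] by (simp flip: inner_minus_left)
  ultimately have "L (z - p) \<bullet> d \<le> 0" using pred(2) by (simp add: d_def)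
  moreover have "L (z - p) = d - e" by (simp add: d_def e_def L.diff)
  ultimately have "d \<bullet> d \<le> e \<bullet> d" by (simp add: inner_diff_left)
  then have *: "2 * \<alpha> * (d \<bullet> d) \<le> 2 * \<alpha> * (e \<bullet> d)"
    using \<open>\<alpha> > 0\<close> by simp
  have "L (dp_balm_step \<theta> X A b \<beta> \<delta> \<alpha> w) - L z = e - \<alpha> *\<^sub>R d"
    by (simp add: dp_balm_step_predictor L.diff L.scale e_def d_def p_def)
  then have "(norm (L (dp_balm_step \<theta> X A b \<beta> \<delta> \<alpha> w) - L z))\<^sup>2
      = e \<bullet> e - 2 * \<alpha> * (e \<bullet> d) + \<alpha> * \<alpha> * (d \<bullet> d)"
    by (simp add: power2_norm_eq_inner inner_diff_left inner_diff_right inner_commute)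
  also have "\<dots> \<le> e \<bullet> e - \<alpha> * (2 - \<alpha>) * (d \<bullet> d)"
    using * by (simp add: algebra_simps)
  finally show ?thesis by (simp add: e_def d_def p_def power2_norm_eq_inner)
qed

section \<open>Convergence\<close>

theorem theorem3p2:
  fixes \<theta> :: "real ^ 'n \<Rightarrow> real" and X :: "(real ^ 'n) set"
    and A :: "real ^ 'n ^ 'm" and b :: "real ^ 'm"
    and \<beta> \<delta> \<alpha> :: real
    and w :: "nat \<Rightarrow> (real ^ 'n) \<times> (real ^ 'm)"
  assumes "convex_on UNIV \<theta>"
    and "closed X" and "convex X"
    and "VI_solutions \<theta> X A b \<noteq> {}"
    and "\<beta> > 0" and "\<delta> > 0" and "0 < \<alpha>" and "\<alpha> < 2"
    and "\<And>k. w (Suc k) = dp_balm_step \<theta> X A b \<beta> \<delta> \<alpha> (w k)"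
  shows "\<exists>w_inf \<in> VI_solutions \<theta> X A b. w \<longlonglongrightarrow> w_inf"
proof -
  define S where "S = VI_solutions \<theta> X A b"
  define L where "L = H_factor A \<beta> \<delta>"
  define p where "p k = predictor \<theta> X A b \<beta> \<delta> (w k)" for k
  interpret L: linear L unfolding L_def by (rule linear_H_factor)
  have "inj L" unfolding L_def using assms by (intro inj_H_factor)
  \<comment> \<open>The Fejer argument runs on \<open>L \<circ> w\<close>, where the
    \<open>H\<close>-norm has become the Euclidean distance; \<open>L'\<close> carries limits back
    to \<open>w\<close>.\<close>
  then obtain L' where L': "linear L'" "\<And>v. L' (L v) = v"
    using linear_injective_left_inverse[OF L.linear_axioms] by (auto simp: fun_eq_iff)
  have L'_lim: "((\<lambda>i. L' (f i)) \<longlongrightarrow> L' l) F" if "(f \<longlongrightarrow> l) F" for f l and F :: "nat filter"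
    using that L'(1) linear_continuous_at linear_conv_bounded_linear isCont_tendsto_compose by blast
  have L_lim: "((\<lambda>i. L (f i)) \<longlongrightarrow> L l) F" if "(f \<longlongrightarrow> l) F" for f l and F :: "nat filter"
    using that L.linear_axioms linear_continuous_at linear_conv_bounded_linear isCont_tendsto_compose by blast
  have decr: "(norm (L (w (Suc k)) - L z))\<^sup>2
      \<le> (norm (L (w k) - L z))\<^sup>2 - \<alpha> * (2 - \<alpha>) * (norm (L (w k - p k)))\<^sup>2" if "z \<in> S" for z k
    unfolding assms(9) L_def p_def
    using assms that by (intro H_factor_contraction) (auto simp: S_def)
  \<comment> \<open>Both bounds on \<alpha> enter here: the guaranteed decrease has a positive
    coefficient.\<close>
  have \<alpha>: "\<alpha> * (2 - \<alpha>) > 0" using assms by simp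
  obtain z where "z \<in> S" using assms unfolding S_def by blast
  then have "fst z \<in> X" by (auto simp: S_def VI_solutions_def)
  then have "X \<noteq> {}" by blast
  have res: "(\<lambda>k. w k - p k) \<longlonglongrightarrow> 0"
  proof -
    \<comment> \<open>Being nonincreasing and nonnegative, \<open>a\<close> converges, so its
      consecutive differences tend to 0 and squeeze the residuals.\<close>
    define a where "a k = (norm (L (w k) - L z))\<^sup>2" for k
    have step: "\<alpha> * (2 - \<alpha>) * (norm (L (w k - p k)))\<^sup>2 \<le> a k - a (Suc k)" for k
      using decr[OF \<open>z \<in> S\<close>, of k] by (simp add: a_def)
    moreover have "\<alpha> * (2 - \<alpha>) * (norm (L (w k - p k)))\<^sup>2 \<ge> 0" for k
      using \<alpha> by simp
    ultimately have "decseq a" by (intro decseq_SucI) (smt (verit))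
    moreover have "a k \<ge> 0" for k by (simp add: a_def)
    ultimately obtain l where "a \<longlonglongrightarrow> l" using decseq_convergent by blast
    then have "(\<lambda>k. a k - a (Suc k)) \<longlonglongrightarrow> l - l"
      by (intro tendsto_diff LIMSEQ_Suc)
    then have "(\<lambda>k. (a k - a (Suc k)) / (\<alpha> * (2 - \<alpha>))) \<longlonglongrightarrow> 0"
      using tendsto_divide_zero by auto
    then have "(\<lambda>k. (norm (L (w k - p k)))\<^sup>2) \<longlonglongrightarrow> 0"
    proof (rule tendsto_sandwich[rotated 3])
      show "\<forall>\<^sub>F k in sequentially. (norm (L (w k - p k)))\<^sup>2 \<le> (a k - a (Suc k)) / (\<alpha> * (2 - \<alpha>))"
        using step \<alpha> by (intro always_eventually allI) (simp add: pos_le_divide_eq mult.commute)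
    qed auto
    then have "(\<lambda>k. L (w k - p k)) \<longlonglongrightarrow> 0"
      by (simp add: tendsto_norm_zero_iff)
    from L'_lim[OF this] show ?thesis
      using linear_0[OF L'(1)] by (simp add: L'(2))
  qed
  have cluster: "l \<in> L ` S" if r: "strict_mono r" "((L \<circ> w) \<circ> r) \<longlonglongrightarrow> l" for r l
  proof -
    define q where "q = L' l"
    have wr: "(\<lambda>i. w (r i)) \<longlonglongrightarrow> q"
      using L'_lim[OF r(2)] by (simp add: q_def L'(2))
    have resr: "(\<lambda>i. w (r i) - p (r i)) \<longlonglongrightarrow> 0"
      using LIMSEQ_subseq_LIMSEQ[OF res r(1)] by (simp add: o_def)
    \<comment> \<open>The predictors lie in \<open>X\<close> and satisfy the perturbed inequality,
      while the relaxed iterates may leave \<open>X\<close>; vanishing residuals give both the same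
      limit.\<close>
    have pr: "(\<lambda>i. p (r i)) \<longlonglongrightarrow> q"
      using tendsto_diff[OF wr resr] by simp
    have "fst q \<in> X"
    proof (rule closed_sequentially[OF \<open>closed X\<close>])
      show "fst (p (r i)) \<in> X" for i
        unfolding p_def using assms \<open>X \<noteq> {}\<close> by (intro predictor_mem)
    qed (rule tendsto_fst[OF pr])
    moreover have "\<theta> (fst v) - \<theta> (fst q) + (v - q) \<bullet> VI_operator A b q \<ge> 0" if "fst v \<in> X" for v
    proof -
      have "isCont \<theta> (fst q)"
        using convex_on_UNIV_continuous[OF assms(1), of UNIV] by (simp add: continuous_on_eq_continuous_at)
      then have "(\<lambda>i. \<theta> (fst (p (r i)))) \<longlonglongrightarrow> \<theta> (fst q)"
        using tendsto_fst[OF pr] by (rule isCont_tendsto_compose)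
      moreover have "(\<lambda>i. VI_operator A b (p (r i))) \<longlonglongrightarrow> VI_operator A b q"
        unfolding VI_operator_def
        by (intro tendsto_intros pr
            isCont_tendsto_compose[OF matrix_vector_mult_linear_continuous_at])
      ultimately have lhs: "(\<lambda>i. \<theta> (fst v) - \<theta> (fst (p (r i))) + (v - p (r i)) \<bullet> VI_operator A b (p (r i)))
          \<longlonglongrightarrow> \<theta> (fst v) - \<theta> (fst q) + (v - q) \<bullet> VI_operator A b q"
        by (intro tendsto_intros pr)
      \<comment> \<open>The perturbation vanishes in the limit, since \<open>L 0 = 0\<close>, which
        leaves the unperturbed inequality at \<open>q\<close>.\<close>
      have "(\<lambda>i. L (v - p (r i)) \<bullet> L (w (r i) - p (r i))) \<longlonglongrightarrow> L (v - q) \<bullet> L 0"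
        by (intro tendsto_inner L_lim tendsto_intros pr resr)
      moreover have "L (v - p (r i)) \<bullet> L (w (r i) - p (r i))
          \<le> \<theta> (fst v) - \<theta> (fst (p (r i))) + (v - p (r i)) \<bullet> VI_operator A b (p (r i))" for i
        unfolding p_def L_def using assms \<open>X \<noteq> {}\<close> that by (intro predictor_VI)
      ultimately have "L (v - q) \<bullet> L 0 \<le> \<theta> (fst v) - \<theta> (fst q) + (v - q) \<bullet> VI_operator A b q"
        using lhs by (blast intro: LIMSEQ_le)
      then show ?thesis by (simp add: L.zero)
    qed
    ultimately have "q \<in> S"
      by (auto simp: S_def VI_solutions_def mem_Times_iff)
    moreover have "l = L q"
      using LIMSEQ_unique[OF r(2)] L_lim[OF wr] by (simp add: o_def)
    ultimately show ?thesis by blast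
  qed
  have "\<exists>l \<in> L ` S. (L \<circ> w) \<longlonglongrightarrow> l"
  proof (rule Fejer_monotone_converges[OF _ _ cluster])
    show "L ` S \<noteq> {}" using \<open>z \<in> S\<close> by blast
    show "dist ((L \<circ> w) (Suc k)) y \<le> dist ((L \<circ> w) k) y" if y: "y \<in> L ` S" for y k
    proof -
      obtain u where u: "u \<in> S" "y = L u" using y by blast
      \<comment> \<open>Dropping the nonnegative decrease leaves plain monotonicity of the
        distance.\<close>
      have "\<alpha> * (2 - \<alpha>) * (norm (L (w k - p k)))\<^sup>2 \<ge> 0" using \<alpha> by simp
      then have "(norm (L (w (Suc k)) - y))\<^sup>2 \<le> (norm (L (w k) - y))\<^sup>2"
        using decr[OF u(1), of k] unfolding u(2) by linarith
      then show ?thesis by (simp add: dist_norm)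
    qed
  qed
  then obtain q where "q \<in> S" "(L \<circ> w) \<longlonglongrightarrow> L q" by blast
  then have "w \<longlonglongrightarrow> q" using L'_lim[of "L \<circ> w" "L q"] by (simp add: L'(2))
  with \<open>q \<in> S\<close> show ?thesis unfolding S_def by blast
qed

end
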